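(* Fix $k\in\mathbb Z_{\ge0}$ and an irreducible fraction $t\in(0,1)$. Then the Hirzebruch–Jung continued fraction expansion of $\dfrac{m_{k,t}}{u^+_{k,t}}$ is a $k$-Wahl chain.
   Context: Farey tree $\mathrm{F}\mathbb T$: root $\left(\frac01,\frac11,\frac10\right)$; vertex $\left(\frac ab,\frac cd,\frac ef\right)$ has left child $\left(\frac ab,\frac{a+c}{b+d},\frac cd\right)$ and right child $\left(\frac cd,\frac{c+e}{d+f},\frac ef\right)$. $\mathrm{M}\mathbb T(k)$: root $(1,k+2,1)$; vertex $(a,b,c)$ has left child $\left(a,\frac{a^2+kab+b^2}{c},b\right)$ and right child $\left(b,\frac{b^2+kbc+c^2}{a},c\right)$. Let $\theta\colon\mathrm{F}\mathbb T\to\mathrm{M}\mathbb T(k)$ be the bijection preserving root and left/right children. For irreducible $t\in(0,1)$ let $(r,t,s)$ be the vertex of $\mathrm{F}\mathbb T$ with middle entry $t$, $(m_r,m_t,m_s)=\theta(r,t,s)$, $m_{k,t}:=m_t$, and $u^+_{k,t}$ the unique $x\in(0,m_t)$ with $m_rx\equiv m_s\pmod{m_t}$. Every rational $x>1$ has a unique Hirzebruch–Jung expansion $x=[[b_1,\dots,b_s]]:=b_1-\cfrac1{b_2-\cfrac1{\ddots-\cfrac1{b_s}}}$ with integers $b_i\ge2$. $k$-Wahl chains are defined recursively: $[[k+2]]$ is a $k$-Wahl chain; if $[[b_1,\dots,b_\ell]]$ is a $k$-Wahl chain, so are $[[b_1+1,b_2,\dots,b_\ell,2]]$ and $[[2,b_1,\dots,b_{\ell-1},b_\ell+1]]$.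 *)

theory Defs
  imports Complex_Main "HOL-Number_Theory.Cong"
begin

section \<open>The two trees\<close>

text \<open>
  Positions in the infinite rooted binary tree. A position is the list of the moves leading to it
  from the root, with the most recent move at the head.
\<close>

datatype move = L | R

type_synonym position = "move list"

text \<open>A fraction \<open>a/b\<close> is the pair \<open>(a, b)\<close>, so that \<open>1/0\<close> is available.\<close>

type_synonym fraction = "int \<times> int"
type_synonym farey_triple = "fraction \<times> fraction \<times> fraction"
type_synonym markov_triple = "int \<times> int \<times> int"

definition FT_root :: farey_triple where
  "FT_root = ((0, 1), (1, 1), (1, 0))"

fun FT_left :: "farey_triple \<Rightarrow> farey_triple" where
  "FT_left ((a, b), (c, d), (e, f)) = ((a, b), (a + c, b + d), (c, d))"

fun FT_right :: "farey_triple \<Rightarrow> farey_triple" where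
  "FT_right ((a, b), (c, d), (e, f)) = ((c, d), (c + e, d + f), (e, f))"

fun FT_at :: "position \<Rightarrow> farey_triple" where
  "FT_at [] = FT_root"
| "FT_at (L # p) = FT_left (FT_at p)"
| "FT_at (R # p) = FT_right (FT_at p)"

definition MT_root :: "int \<Rightarrow> markov_triple" where
  "MT_root k = (1, k + 2, 1)"

text \<open>The divisions are exact on the tree; see \<open>MT_left_exact\<close> and \<open>MT_right_exact\<close> below.\<close>

fun MT_left :: "int \<Rightarrow> markov_triple \<Rightarrow> markov_triple" where
  "MT_left k (a, b, c) = (a, (a\<^sup>2 + k * a * b + b\<^sup>2) div c, b)"

fun MT_right :: "int \<Rightarrow> markov_triple \<Rightarrow> markov_triple" where
  "MT_right k (a, b, c) = (b, (b\<^sup>2 + k * b * c + c\<^sup>2) div a, c)"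

fun MT_at :: "int \<Rightarrow> position \<Rightarrow> markov_triple" where
  "MT_at k [] = MT_root k"
| "MT_at k (L # p) = MT_left k (MT_at k p)"
| "MT_at k (R # p) = MT_right k (MT_at k p)"

definition FT :: "farey_triple set" where
  "FT = range FT_at"

definition MT :: "int \<Rightarrow> markov_triple set" where
  "MT k = range (MT_at k)"

text \<open>
  The bijection respecting the roots and the children; the lemmas \<open>theta_root\<close>, \<open>theta_left\<close>,
  \<open>theta_right\<close> and \<open>theta_bij\<close> below state these properties.
\<close>

definition theta :: "int \<Rightarrow> farey_triple \<Rightarrow> markov_triple" where
  "theta k v = MT_at k (THE p. FT_at p = v)"


section \<open>The numbers attached to a rational\<close>

fun middle :: "'a \<times> 'b \<times> 'c \<Rightarrow> 'b" where
  "middle (x, y, z) = y"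

text \<open>\<open>quotient_of t\<close> is the irreducible fraction (with positive denominator) representing \<open>t\<close>.\<close>

definition FT_vertex :: "rat \<Rightarrow> farey_triple" where
  "FT_vertex t = (THE v. v \<in> FT \<and> middle v = quotient_of t)"

definition markov_number :: "int \<Rightarrow> rat \<Rightarrow> int" where
  "markov_number k t = middle (theta k (FT_vertex t))"

definition u_plus :: "int \<Rightarrow> rat \<Rightarrow> int" where
  "u_plus k t = (case theta k (FT_vertex t) of (m\<^sub>r, m\<^sub>t, m\<^sub>s) \<Rightarrow>
     THE x. 0 < x \<and> x < m\<^sub>t \<and> [m\<^sub>r * x = m\<^sub>s] (mod m\<^sub>t))"


section \<open>Hirzebruch--Jung continued fractions and Wahl chains\<close>

fun hj_value :: "int list \<Rightarrow> rat" where
  "hj_value [] = undefined"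
| "hj_value [b] = of_int b"
| "hj_value (b # b' # bs) = of_int b - 1 / hj_value (b' # bs)"

definition hj_expansion :: "rat \<Rightarrow> int list" where
  "hj_expansion x = (THE bs. bs \<noteq> [] \<and> (\<forall>b \<in> set bs. 2 \<le> b) \<and> hj_value bs = x)"

inductive wahl_chain :: "int \<Rightarrow> int list \<Rightarrow> bool" for k :: int where
  base: "wahl_chain k [k + 2]"
| incr_first: "wahl_chain k (b # bs) \<Longrightarrow> wahl_chain k ((b + 1) # bs @ [2])"
| incr_last: "wahl_chain k (bs @ [b]) \<Longrightarrow> wahl_chain k (2 # bs @ [b + 1])"


section \<open>Well-definedness\<close>

subsection \<open>The Farey tree\<close>

lemma FT_at_invariants:
  assumes "FT_at p = ((a, b), (c, d), (e, f))"
  shows "c = a + e \<and> d = b + f \<and> b * e - a * f = 1 \<and> 0 \<le> a \<and> 1 \<le> b \<and> 1 \<le> e \<and> 0 \<le> f"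
  using assms
proof (induction p arbitrary: a b c d e f rule: FT_at.induct)
  case 1
  then show ?case by (auto simp: FT_root_def)
next
  case (2 p)
  obtain a' b' c' d' e' f' where v: "FT_at p = ((a', b'), (c', d'), (e', f'))"
    by (metis prod.exhaust)
  show ?case using "2.IH"[OF v] "2.prems" v by (auto simp: algebra_simps)
next
  case (3 p)
  obtain a' b' c' d' e' f' where v: "FT_at p = ((a', b'), (c', d'), (e', f'))"
    by (metis prod.exhaust)
  show ?case using "3.IH"[OF v] "3.prems" v by (auto simp: algebra_simps)
qed

lemma FT_at_surj:
  assumes "b * e - a * f = 1" "0 \<le> a" "0 \<le> b" "0 \<le> e" "0 \<le> f"
  shows "\<exists>p. FT_at p = ((a, b), (a + e, b + f), (e, f))"
  using assms
proof (induction "nat (a + b + e + f)" arbitrary: a b e f rule: less_induct)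
  case less
  have ab: "0 < a + b"
  proof (rule ccontr)
    assume "\<not> 0 < a + b"
    then have "a = 0" "b = 0" using less.prems by auto
    then show False using less.prems by simp
  qed
  have ef: "0 < e + f"
  proof (rule ccontr)
    assume "\<not> 0 < e + f"
    then have "e = 0" "f = 0" using less.prems by auto
    then show False using less.prems by simp
  qed
  consider "a \<le> e" "b \<le> f" | "e \<le> a" "f \<le> b" | "a + 1 \<le> e" "f + 1 \<le> b" | "e + 1 \<le> a" "b + 1 \<le> f"
    by linarith
  then show ?case
  proof cases
    case 1
    have "\<exists>p. FT_at p = ((a, b), (a + (e - a), b + (f - b)), (e - a, f - b))"
      by (rule less.hyps) (use 1 ab less.prems in \<open>auto simp: algebra_simps\<close>)
    then obtain p where "FT_at p = ((a, b), (e, f), (e - a, f - b))" by auto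
    then have "FT_at (L # p) = ((a, b), (a + e, b + f), (e, f))" by simp
    then show ?thesis by blast
  next
    case 2
    have "\<exists>p. FT_at p = ((a - e, b - f), (a - e + e, b - f + f), (e, f))"
      by (rule less.hyps) (use 2 ef less.prems in \<open>auto simp: algebra_simps\<close>)
    then obtain p where "FT_at p = ((a - e, b - f), (a, b), (e, f))" by auto
    then have "FT_at (R # p) = ((a, b), (a + e, b + f), (e, f))" by simp
    then show ?thesis by blast
  next
    case 3
    have "(f + 1) * (a + 1) \<le> b * e"
      by (rule mult_mono) (use 3 less.prems in auto)
    then have "a + f \<le> 0" using less.prems(1) by (simp add: algebra_simps)
    then have "a = 0" "f = 0" using less.prems by auto
    moreover from this have "b * e = 1" using less.prems by simp
    then have "b = 1 \<and> e = 1" using less.prems by (auto simp: zmult_eq_1_iff)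
    ultimately have "FT_at [] = ((a, b), (a + e, b + f), (e, f))" by (simp add: FT_root_def)
    then show ?thesis by blast
  next
    case 4
    have "b * e \<le> f * a" by (rule mult_mono) (use 4 less.prems in auto)
    then show ?thesis using less.prems(1) by (simp add: algebra_simps)
  qed
qed

lemma inj_FT_at: "inj FT_at"
proof -
  have "FT_at p = FT_at q \<Longrightarrow> p = q" for p q
  proof (induction p arbitrary: q)
    case Nil
    show ?case
    proof (cases q)
      case (Cons x q')
      obtain a b c d e f where v: "FT_at q' = ((a, b), (c, d), (e, f))" by (metis prod.exhaust)
      show ?thesis using Nil Cons v FT_at_invariants[OF v]
        by (cases x) (auto simp: FT_root_def)
    qed simp
  next
    case (Cons x p)
    obtain a b c d e f where v: "FT_at p = ((a, b), (c, d), (e, f))" by (metis prod.exhaust)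
    note i = FT_at_invariants[OF v]
    show ?case
    proof (cases q)
      case Nil
      then show ?thesis using Cons.prems v i by (cases x) (auto simp: FT_root_def)
    next
      case q: (Cons y q')
      obtain a' b' c' d' e' f' where v': "FT_at q' = ((a', b'), (c', d'), (e', f'))"
        by (metis prod.exhaust)
      note i' = FT_at_invariants[OF v']
      have "x = y \<and> FT_at p = FT_at q'"
        using Cons.prems q v v' i i' by (cases x; cases y) auto
      then show ?thesis using Cons.IH q by simp
    qed
  qed
  then show ?thesis by (rule injI)
qed

lemma FT_vertex_ex1:
  assumes "0 < t"
  shows "\<exists>!v. v \<in> FT \<and> middle v = quotient_of t"
proof -
  obtain c d where cd: "quotient_of t = (c, d)" by (metis prod.exhaust)
  have d: "0 < d" and cop: "coprime c d" and "t = of_int c / of_int d"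
    using cd quotient_of_denom_pos quotient_of_coprime quotient_of_div by auto
  then have c: "0 < c" using assms by (simp add: zero_less_divide_iff)
  obtain x where x: "[c * x = 1] (mod d)"
    using cop cong_solve_coprime_int by blast
  define b where "b = (x - 1) mod d + 1"
  have b: "1 \<le> b" "b \<le> d"
    using d by (auto simp: b_def add1_zle_eq)
  have "[b = x] (mod d)"
    unfolding b_def cong_def by (metis diff_add_cancel mod_add_left_eq)
  then have "[c * b = 1] (mod d)"
    using x by (meson cong_scalar_left cong_trans)
  then obtain a where a: "c * b - 1 = d * a"
    by (auto simp: cong_iff_dvd_diff dvd_def)
  have "c * b \<ge> 1 * 1" by (rule mult_mono) (use c b in auto)
  then have a0: "0 \<le> a" using a d by (metis diff_ge_0_iff_ge mult_1 zero_le_mult_iff not_le)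
  have "d * a < d * c"
    using a b c mult_left_mono[of b d c] mult.commute[of c d] by linarith
  then have ac: "a < c" using d by simp
  have "b * (c - a) - a * (d - b) = 1"
    using a by (simp add: algebra_simps)
  then obtain p where "FT_at p = ((a, b), (a + (c - a), b + (d - b)), (c - a, d - b))"
    using FT_at_surj[of b "c - a" a "d - b"] a0 ac b by auto
  then have ex: "\<exists>v. v \<in> FT \<and> middle v = quotient_of t"
    unfolding FT_def using cd by (intro exI[of _ "FT_at p"] conjI rangeI) simp
  have uniq: "v = ((a, b), (c, d), (c - a, d - b))" if v: "v \<in> FT" "middle v = quotient_of t" for v
  proof -
    obtain p where p: "v = FT_at p" using v(1) unfolding FT_def by blast
    obtain a' b' c' d' e f where "FT_at p = ((a', b'), (c', d'), (e, f))" by (metis prod.exhaust)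
    then have w: "FT_at p = ((a', b'), (c, d), (e, f))" using v(2) p cd by simp
    note i = FT_at_invariants[OF w]
    have h: "c * b' - 1 = d * a'" using i by (simp add: algebra_simps)
    have "c * (b' - b) = d * (a' - a)" using h a by (simp add: algebra_simps)
    then have "d dvd b' - b"
      using cop by (metis coprime_commute coprime_dvd_mult_right_iff dvd_triv_left)
    moreover have "\<bar>b' - b\<bar> < d" using i b by auto
    ultimately have "b' = b"
      by (metis dvd_imp_le_int not_le abs_of_pos d right_minus_eq)
    then have "a' = a" using h a d by auto
    then show ?thesis using w p i \<open>b' = b\<close> by simp
  qed
  from ex uniq show ?thesis by metis
qed


subsection \<open>The tree of generalized Markov triples\<close>

lemma MT_at_invariants:
  assumes "0 \<le> k" "MT_at k p = (a, b, c)"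
  shows "a\<^sup>2 + b\<^sup>2 + c\<^sup>2 + k * (a * b + b * c + c * a) = (3 + 3 * k) * a * b * c
    \<and> 1 \<le> a \<and> 1 \<le> c \<and> a < b \<and> c < b \<and> coprime a b \<and> coprime b c"
    and "c dvd a\<^sup>2 + k * a * b + b\<^sup>2" and "a dvd b\<^sup>2 + k * b * c + c\<^sup>2"
proof -
  let ?eq = "\<lambda>a b c. a\<^sup>2 + b\<^sup>2 + c\<^sup>2 + k * (a * b + b * c + c * a) = (3 + 3 * k) * a * b * c"
  let ?I = "\<lambda>a b c. ?eq a b c \<and> 1 \<le> a \<and> 1 \<le> c \<and> a < b \<and> c < b \<and> coprime a b \<and> coprime b c"
  have left: "a\<^sup>2 + k * a * b + b\<^sup>2 = c * ((3 + 3 * k) * a * b - k * (a + b) - c)"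
    if "?eq a b c" for a b c
    using that by (simp add: algebra_simps power2_eq_square)
  have sym: "?eq c b a" if "?eq a b c" for a b c
    using that by (simp add: algebra_simps)
  have step: "?eq a b' b \<and> 1 \<le> a \<and> a < b' \<and> b < b' \<and> coprime a b' \<and> coprime b' b"
    if I: "?I a b c" and b': "b' = (a\<^sup>2 + k * a * b + b\<^sup>2) div c" for a b c b'
  proof -
    have c: "c > 0" using I by auto
    have v: "b' = (3 + 3 * k) * a * b - k * (a + b) - c"
      using left[of a b c] I b' by simp
    have prod: "c * b' = a\<^sup>2 + k * a * b + b\<^sup>2" using left[of a b c] I v by simp
    have "?eq a b' b"
    proof -
      have "a\<^sup>2 + b'\<^sup>2 + b\<^sup>2 + k * (a * b' + b' * b + b * a) - (3 + 3 * k) * a * b' * b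
        = c * b' + b' * (b' + k * (a + b) - (3 + 3 * k) * a * b)"
        unfolding prod by (simp add: algebra_simps power2_eq_square)
      also have "\<dots> = 0" unfolding v by (simp add: algebra_simps)
      finally show ?thesis by simp
    qed
    moreover have "b < b'"
    proof -
      have "0 \<le> k * a * b" "0 < a\<^sup>2" using I assms(1) by auto
      then have "b\<^sup>2 < c * b'" using prod by linarith
      moreover have "c * b \<le> b\<^sup>2" using I by (simp add: power2_eq_square)
      ultimately have "c * b < c * b'" by simp
      then show ?thesis using c by simp
    qed
    moreover have "coprime a b'"
    proof (rule coprimeI)
      fix g assume g: "g dvd a" "g dvd b'"
      have "b\<^sup>2 = c * b' - a * (a + k * b)"
        using prod by (simp add: algebra_simps power2_eq_square)
      then have "g dvd b\<^sup>2" using g by simp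
      moreover have "coprime a (b\<^sup>2)" using I by simp
      ultimately show "is_unit g" using g(1) coprime_common_divisor by blast
    qed
    moreover have "coprime b' b"
    proof (rule coprimeI)
      fix g assume g: "g dvd b'" "g dvd b"
      have "a\<^sup>2 = c * b' - b * (b + k * a)"
        using prod by (simp add: algebra_simps power2_eq_square)
      then have "g dvd a\<^sup>2" using g by simp
      moreover have "coprime (a\<^sup>2) b" using I by simp
      ultimately show "is_unit g" using g(2) coprime_common_divisor by blast
    qed
    ultimately show ?thesis using I by auto
  qed
  have "?I a b c" using assms(2)
  proof (induction p arbitrary: a b c)
    case Nil
    then show ?case using assms(1)
      by (auto simp: MT_root_def algebra_simps power2_eq_square)
  next
    case (Cons x p)
    obtain a' b' c' where v: "MT_at k p = (a', b', c')" by (metis prod.exhaust)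
    note I = Cons.IH[OF v]
    show ?case
    proof (cases x)
      case L
      then have "a = a'" "c = b'" "b = (a'\<^sup>2 + k * a' * b' + b'\<^sup>2) div c'"
        using Cons.prems v by auto
      then show ?thesis using step[OF I, of b] I by auto
    next
      case R
      have J: "?I c' b' a'" using I sym[of a' b' c'] by (auto simp: coprime_commute)
      have e: "a = b'" "c = c'" "b = (c'\<^sup>2 + k * c' * b' + b'\<^sup>2) div a'"
        using R Cons.prems v by (auto simp: algebra_simps)
      have S: "?eq c b a \<and> 1 \<le> c \<and> c < b \<and> a < b \<and> coprime c b \<and> coprime b a"
        using step[OF J e(3)] unfolding e(1,2) .
      then show ?thesis using sym[of c b a] I e by (auto simp: coprime_commute)
    qed
  qed
  then show I: "?I a b c" .
  show "c dvd a\<^sup>2 + k * a * b + b\<^sup>2" using left[of a b c] I by simp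
  have "c\<^sup>2 + k * c * b + b\<^sup>2 = a * ((3 + 3 * k) * c * b - k * (c + b) - a)"
    using left[of c b a] sym[of a b c] I by blast
  then have "b\<^sup>2 + k * b * c + c\<^sup>2 = a * ((3 + 3 * k) * c * b - k * (c + b) - a)"
    by (simp add: algebra_simps)
  then show "a dvd b\<^sup>2 + k * b * c + c\<^sup>2" by simp
qed

lemma MT_left_exact:
  assumes "0 \<le> k" "(a, b, c) \<in> MT k"
  shows "c \<noteq> 0 \<and> c dvd a\<^sup>2 + k * a * b + b\<^sup>2"
proof -
  obtain p where "MT_at k p = (a, b, c)" using assms(2) unfolding MT_def by force
  then show ?thesis using MT_at_invariants[OF assms(1)] by fastforce
qed

lemma MT_right_exact:
  assumes "0 \<le> k" "(a, b, c) \<in> MT k"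
  shows "a \<noteq> 0 \<and> a dvd b\<^sup>2 + k * b * c + c\<^sup>2"
proof -
  obtain p where "MT_at k p = (a, b, c)" using assms(2) unfolding MT_def by force
  then show ?thesis using MT_at_invariants[OF assms(1)] by fastforce
qed

lemma inj_MT_at:
  assumes "0 \<le> k"
  shows "inj (MT_at k)"
proof -
  have "MT_at k p = MT_at k q \<Longrightarrow> p = q" for p q
  proof (induction p arbitrary: q)
    case Nil
    show ?case
    proof (cases q)
      case (Cons x q')
      obtain a b c where v: "MT_at k q' = (a, b, c)" by (metis prod.exhaust)
      show ?thesis using Nil Cons v MT_at_invariants(1)[OF assms v]
        by (cases x) (auto simp: MT_root_def)
    qed simp
  next
    case (Cons x p)
    obtain a b c where v: "MT_at k p = (a, b, c)" by (metis prod.exhaust)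
    note i = MT_at_invariants[OF assms v]
    show ?case
    proof (cases q)
      case Nil
      then show ?thesis using Cons.prems v i(1) by (cases x) (auto simp: MT_root_def)
    next
      case q: (Cons y q')
      obtain a' b' c' where v': "MT_at k q' = (a', b', c')" by (metis prod.exhaust)
      note i' = MT_at_invariants[OF assms v']
      have xy: "x = y"
        using Cons.prems q v v' i(1) i'(1) by (cases x; cases y) auto
      have cancel: "w = w'"
        if "w dvd n" "w' dvd n" "n div w = n div w'" "0 < n" for w w' n :: int
        using that by (metis dvd_div_mult_self mult_cancel_left mult_zero_left less_irrefl)
      have "MT_at k p = MT_at k q'"
      proof (cases x)
        case L
        have e: "a = a'" "b = b'"
          "(a\<^sup>2 + k * a * b + b\<^sup>2) div c = (a'\<^sup>2 + k * a' * b' + b'\<^sup>2) div c'"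
          using L xy Cons.prems q v v' by auto
        have "0 < a\<^sup>2 + k * a * b + b\<^sup>2"
          using i(1) assms by (intro add_nonneg_pos add_nonneg_nonneg) auto
        then have "c = c'" using cancel[OF i(2) _ e(3)[folded e(1,2)]] i'(2) e by simp
        then show ?thesis using e v v' by simp
      next
        case R
        have e: "b = b'" "c = c'"
          "(b\<^sup>2 + k * b * c + c\<^sup>2) div a = (b'\<^sup>2 + k * b' * c' + c'\<^sup>2) div a'"
          using R xy Cons.prems q v v' by auto
        have "0 < b\<^sup>2 + k * b * c + c\<^sup>2"
          using i(1) assms by (intro add_nonneg_pos add_nonneg_nonneg) auto
        then have "a = a'" using cancel[OF i(3) _ e(3)[folded e(1,2)]] i'(3) e by simp
        then show ?thesis using e v v' by simp
      qed
      then show ?thesis using Cons.IH q xy by simp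
    qed
  qed
  then show ?thesis by (rule injI)
qed

lemma theta_FT_at [simp]: "theta k (FT_at p) = MT_at k p"
proof -
  have "(THE q. FT_at q = FT_at p) = p"
    using inj_FT_at by (auto dest: injD)
  then show ?thesis by (simp add: theta_def)
qed

lemma theta_root: "theta k FT_root = MT_root k"
  using theta_FT_at[of k "[]"] by simp

lemma theta_left: "v \<in> FT \<Longrightarrow> theta k (FT_left v) = MT_left k (theta k v)"
  using theta_FT_at[of k "L # _"] by (auto simp: FT_def)

lemma theta_right: "v \<in> FT \<Longrightarrow> theta k (FT_right v) = MT_right k (theta k v)"
  using theta_FT_at[of k "R # _"] by (auto simp: FT_def)

lemma theta_bij:
  assumes "0 \<le> k"
  shows "bij_betw (theta k) FT (MT k)"
  using inj_MT_at[OF assms]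
  by (auto simp: bij_betw_def inj_on_def FT_def MT_def image_image dest!: injD)

lemma u_plus_ex1:
  assumes "0 \<le> k" "(m\<^sub>r, m\<^sub>t, m\<^sub>s) \<in> MT k"
  shows "\<exists>!x. 0 < x \<and> x < m\<^sub>t \<and> [m\<^sub>r * x = m\<^sub>s] (mod m\<^sub>t)"
proof -
  obtain p where p: "MT_at k p = (m\<^sub>r, m\<^sub>t, m\<^sub>s)" using assms(2) unfolding MT_def by force
  note i = MT_at_invariants(1)[OF assms(1) p]
  then have cop: "coprime m\<^sub>r m\<^sub>t" and pos: "0 < m\<^sub>t" by auto
  obtain y where y: "[m\<^sub>r * y = 1] (mod m\<^sub>t)" using cop cong_solve_coprime_int by blast
  define x where "x = (y * m\<^sub>s) mod m\<^sub>t"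
  have "[x = y * m\<^sub>s] (mod m\<^sub>t)" by (simp add: x_def cong_def)
  then have "[m\<^sub>r * x = m\<^sub>r * y * m\<^sub>s] (mod m\<^sub>t)"
    by (metis cong_scalar_left mult.assoc)
  also have "[m\<^sub>r * y * m\<^sub>s = 1 * m\<^sub>s] (mod m\<^sub>t)" using y by (rule cong_scalar_right)
  finally have x: "[m\<^sub>r * x = m\<^sub>s] (mod m\<^sub>t)" by simp
  have "x \<noteq> 0"
  proof
    assume "x = 0"
    then have "m\<^sub>s mod m\<^sub>t = 0" using x by (simp add: cong_def)
    then show False using i by simp
  qed
  moreover have "0 \<le> x" "x < m\<^sub>t" using pos by (simp_all add: x_def)
  ultimately have r: "0 < x" "x < m\<^sub>t" by auto
  have "z = x" if z: "0 < z" "z < m\<^sub>t" "[m\<^sub>r * z = m\<^sub>s] (mod m\<^sub>t)" for z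
  proof -
    have "[m\<^sub>r * z = m\<^sub>r * x] (mod m\<^sub>t)" using z(3) x by (metis cong_sym cong_trans)
    then have "[z = x] (mod m\<^sub>t)" using cop by (simp add: cong_mult_lcancel)
    then show ?thesis using z r by (simp add: cong_def)
  qed
  then show ?thesis using r x by blast
qed


subsection \<open>Hirzebruch--Jung expansions\<close>

lemma hj_value_bounds:
  assumes "bs \<noteq> []" "\<forall>b \<in> set bs. 2 \<le> b"
  shows "1 < hj_value bs \<and> of_int (hd bs) - 1 < hj_value bs \<and> hj_value bs \<le> of_int (hd bs)"
  using assms
proof (induction bs rule: hj_value.induct)
  case (3 b b' bs)
  then have h: "1 < hj_value (b' # bs)" by simp
  then have "0 < 1 / hj_value (b' # bs)" "1 / hj_value (b' # bs) < 1" by auto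
  moreover have "(2 :: rat) \<le> of_int b" using "3.prems" by simp
  ultimately have "1 < hj_value (b # b' # bs)" "of_int b - 1 < hj_value (b # b' # bs)"
    "hj_value (b # b' # bs) \<le> of_int b"
    unfolding hj_value.simps by linarith+
  then show ?case by simp
qed auto

lemma hj_expansion_ex1:
  assumes "1 < x"
  shows "\<exists>!bs. bs \<noteq> [] \<and> (\<forall>b \<in> set bs. 2 \<le> b) \<and> hj_value bs = x"
proof (rule ex_ex1I)
  have "\<exists>bs. bs \<noteq> [] \<and> (\<forall>b \<in> set bs. 2 \<le> b) \<and> hj_value bs = of_int p / of_int q"
    if "0 < q" "q < p" for p q :: int
    using that
  proof (induction "nat q" arbitrary: p q rule: less_induct)
    case less
    define b where "b = - ((- p) div q)"
    define r where "r = (- p) mod q"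
    have "r = - p - (- p) div q * q" by (simp only: r_def minus_div_mult_eq_mod)
    then have pr: "p = b * q - r" by (simp add: b_def)
    have r: "0 \<le> r" "r < q" using less.prems by (auto simp: r_def)
    have "1 * q < b * q" using pr r less.prems by linarith
    then have b: "2 \<le> b" using less.prems by simp
    show ?case
    proof (cases "r = 0")
      case True
      then have "hj_value [b] = of_int p / of_int q" using pr less.prems by simp
      then show ?thesis using b by (intro exI[of _ "[b]"]) auto
    next
      case False
      then obtain bs where bs: "bs \<noteq> []" "\<forall>b \<in> set bs. 2 \<le> b" "hj_value bs = of_int q / of_int r"
        using less.hyps[of r q] r less.prems by auto
      then obtain b' bs' where c: "bs = b' # bs'" by (cases bs) auto
      have "hj_value (b # bs) = of_int b - of_int r / of_int q" using bs c by simp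
      also have "\<dots> = of_int p / of_int q"
        unfolding pr using less.prems by (simp add: diff_divide_distrib)
      finally show ?thesis using b bs by (intro exI[of _ "b # bs"]) auto
    qed
  qed
  moreover obtain p q where "quotient_of x = (p, q)" by (metis prod.exhaust)
  then have "0 < q" "x = of_int p / of_int q"
    using quotient_of_denom_pos quotient_of_div by auto
  moreover from this have "q < p" using assms by (simp add: less_divide_eq)
  ultimately show "\<exists>bs. bs \<noteq> [] \<and> (\<forall>b \<in> set bs. 2 \<le> b) \<and> hj_value bs = x" by blast
next
  have "bs = cs"
    if "bs \<noteq> []" "\<forall>b \<in> set bs. 2 \<le> b" "cs \<noteq> []" "\<forall>b \<in> set cs. 2 \<le> b"
      "hj_value bs = hj_value cs" for bs cs
    using that
  proof (induction bs arbitrary: cs)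
    case (Cons b bs)
    obtain c cs' where cs: "cs = c # cs'" using Cons.prems by (cases cs) auto
    have "\<lceil>hj_value (b # bs)\<rceil> = b" "\<lceil>hj_value cs\<rceil> = c"
      using hj_value_bounds[of "b # bs"] hj_value_bounds[of cs] Cons.prems cs
      by (auto simp: ceiling_eq_iff)
    then have bc: "b = c" using Cons.prems by simp
    have pos: "ds = [] \<or> 0 < hj_value ds" if "\<forall>b \<in> set ds. 2 \<le> b" for ds
      using hj_value_bounds[of ds] that by fastforce
    have "bs = cs'"
    proof (cases bs; cases cs')
      fix x xs y ys assume e: "bs = x # xs" "cs' = y # ys"
      then have "hj_value bs = hj_value cs'" using Cons.prems cs bc by simp
      then show ?thesis using Cons.IH[of cs'] Cons.prems cs e by simp
    qed (use Cons.prems cs bc pos[of bs] pos[of cs'] in auto)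
    then show ?case using cs bc by simp
  qed simp
  then show "\<And>bs cs. \<lbrakk>bs \<noteq> [] \<and> (\<forall>b \<in> set bs. 2 \<le> b) \<and> hj_value bs = x;
      cs \<noteq> [] \<and> (\<forall>b \<in> set cs. 2 \<le> b) \<and> hj_value cs = x\<rbrakk> \<Longrightarrow> bs = cs"
    by metis
qed

end

theory Submission
  imports Defs
begin

text \<open>
  Attach to a pair \<open>(m, u)\<close> with \<open>m v = u\<^sup>2 + k u + 1\<close> the binary quadratic form
  \<open>m X\<^sup>2 + (2 u + k) X Y + v Y\<^sup>2\<close> of discriminant \<open>k\<^sup>2 - 4\<close>, or equivalently the matrix with rows
  \<open>(-u, -v)\<close> and \<open>(m, u + k)\<close> in \<open>SL\<^sub>2(\<int>)\<close>. Three such matrices of trace \<open>k\<close> sit at each vertex of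
  the Markov tree, their product is a fixed unipotent matrix, and passing to a child replaces one of
  them by a conjugate. So all the forms stay in the class of \<open>X\<^sup>2 + k X Y + Y\<^sup>2\<close>.
  On the other hand, a form in this class with \<open>0 < u < m\<close> is represented by a pair of neighbours in
  the Stern--Brocot tree, and the two moves in that tree are the two operations on Wahl chains.
\<close>

section \<open>The principal class\<close>

definition principal_form :: "int \<Rightarrow> int \<Rightarrow> int \<Rightarrow> int" where
  "principal_form k x y = x\<^sup>2 + k * x * y + y\<^sup>2"

text \<open>
  With \<open>f = principal_form k\<close>, the substitution with columns \<open>(x, y)\<close> and \<open>(p, z)\<close> turns \<open>f\<close> into
  the form with coefficients \<open>f x y\<close>, \<open>2 * cross_term k p z x y + k\<close> and \<open>f p z\<close>.
\<close>

definition cross_term :: "int \<Rightarrow> int \<Rightarrow> int \<Rightarrow> int \<Rightarrow> int \<Rightarrow> int" where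
  "cross_term k p z x y = p * x + z * y + k * z * x"

text \<open>The columns \<open>(x, y)\<close> and \<open>(p, z)\<close> have determinant
  \<open>- 1\<close>; as the principal form is symmetric in its variables, this gives the same class
  as determinant \<open>1\<close>.\<close>

definition principal :: "int \<Rightarrow> int \<Rightarrow> int \<Rightarrow> bool" where
  "principal k m u \<longleftrightarrow> (\<exists>p z x y. p * y - z * x = 1 \<and>
     m = principal_form k x y \<and> u = cross_term k p z x y)"

lemma principalI:
  "p * y - z * x = 1 \<Longrightarrow> m = principal_form k x y \<Longrightarrow> u = cross_term k p z x y \<Longrightarrow> principal k m u"
  unfolding principal_def by blast

text \<open>A unimodular substitution preserves the discriminant
  \<open>k\<^sup>2 - 4\<close>.\<close>

lemma principal_form_mult:
  assumes "p * y - z * x = 1"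
  shows "principal_form k x y * principal_form k p z
    = (cross_term k p z x y)\<^sup>2 + k * cross_term k p z x y + 1"
proof -
  have "principal_form k x y * principal_form k p z
    = (cross_term k p z x y)\<^sup>2 + k * cross_term k p z x y * (p * y - z * x) + (p * y - z * x)\<^sup>2"
    unfolding principal_form_def cross_term_def by algebra
  then show ?thesis using assms by simp
qed

text \<open>Swapping the variables and negating the second column negates \<open>2 * u + k\<close>.
  This later reduces right moves in the Markov tree to left moves.\<close>

lemma principal_reflect:
  assumes "principal k m u"
  shows "principal k m (- u - k)"
proof -
  obtain p z x y where h: "p * y - z * x = 1" "m = principal_form k x y" "u = cross_term k p z x y"
    using assms unfolding principal_def by blast
  show ?thesis
  proof (rule principalI)
    show "(- z) * x - (- p) * y = 1" using h(1) by simp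
    show "m = principal_form k y x" using h(2) by (simp add: principal_form_def algebra_simps)
    show "- u - k = cross_term k (- z) (- p) y x"
      using h(1) unfolding h(3) cross_term_def by algebra
  qed
qed

text \<open>The matrix of \<open>(b', u')\<close> is the conjugate of that of \<open>(c, w)\<close> by that of \<open>(b, v)\<close>.\<close>

lemma principal_mutation:
  assumes b: "principal k b v" and c: "principal k c w" and "c \<noteq> 0"
    and ac: "a = b * w - (v + k) * c"
    and b': "c * b' = principal_form k a b"
  obtains u' where "principal k b' u'" "a = b' * v - (u' + k) * b"
proof -
  obtain p z x y where h: "p * y - z * x = 1" "c = principal_form k x y" "w = cross_term k p z x y"
    using c unfolding principal_def by blast
  obtain n where n: "b * n = v\<^sup>2 + k * v + 1"
    using b principal_form_mult unfolding principal_def by metis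
  \<comment> \<open>The columns \<open>(p, z)\<close> and \<open>(x, y)\<close> are recombined by
    the matrix with rows \<open>(- v, n)\<close> and \<open>(- b, v + k)\<close>, of determinant
    \<open>1\<close>.\<close>
  define p' where "p' = n * x - v * p"
  define z' where "z' = n * y - v * z"
  define x' where "x' = (v + k) * x - b * p"
  define y' where "y' = (v + k) * y - b * z"
  note defs = p'_def z'_def x'_def y'_def
  have det: "p' * y' - z' * x' = 1" unfolding defs using h(1) n by algebra
  \<comment> \<open>The form of \<open>(c, w)\<close> is evaluated at \<open>(v + k, - b)\<close>;
    multiplying by \<open>c\<close> completes the square.\<close>
  have "c * principal_form k x' y' = principal_form k a b"
  proof -
    have m: "c * principal_form k p z = w\<^sup>2 + k * w + 1" using principal_form_mult h by metis
    have "principal_form k x' y'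
      = b\<^sup>2 * principal_form k p z - b * (v + k) * (2 * w + k) + (v + k)\<^sup>2 * c"
      using h(1) unfolding h(2,3) defs principal_form_def cross_term_def by algebra
    then show ?thesis using m unfolding ac principal_form_def by algebra
  qed
  then have "b' = principal_form k x' y'" using b' \<open>c \<noteq> 0\<close> by (metis mult_cancel_left)
  moreover have "a = principal_form k x' y' * v - (cross_term k p' z' x' y' + k) * b"
    using h(1) n unfolding ac h(2,3) defs principal_form_def cross_term_def by algebra
  ultimately show ?thesis using that det principalI by blast
qed

text \<open>Descent on the sum of absolute values: for mixed signs, an automorph shrinks the larger
  coordinate or makes the signs agree.\<close>

lemma principal_representation_same_sign:
  assumes "p * y - z * x = 1" "0 < principal_form k x y"
  shows "\<exists>p' z' x' y'. p' * y' - z' * x' = 1 \<and> 0 \<le> x' \<and> 0 \<le> y' \<and>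
    principal_form k x' y' = principal_form k x y \<and>
    cross_term k p' z' x' y' = cross_term k p z x y"
  using assms
proof (induction "nat (\<bar>x\<bar> + \<bar>y\<bar>)" arbitrary: p z x y rule: less_induct)
  case less
  note det = less.prems(1)
  have pos: "0 < x\<^sup>2 + k * x * y + y\<^sup>2" using less.prems(2) by (simp add: principal_form_def)
  text \<open>The two maps below are inverse automorphs of the principal form.\<close>
  have forward: "p' * y' - z' * x' = 1"
      "principal_form k x' y' = principal_form k x y"
      "cross_term k p' z' x' y' = cross_term k p z x y"
    if "p' = k * p + z" "z' = - p" "x' = k * x + y" "y' = - x" for p' z' x' y'
    using det unfolding that principal_form_def cross_term_def by algebra+
  have backward: "p' * y' - z' * x' = 1"
      "principal_form k x' y' = principal_form k x y"
      "cross_term k p' z' x' y' = cross_term k p z x y"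
    if "p' = - z" "z' = p + k * z" "x' = - y" "y' = k * y + x" for p' z' x' y'
    using det unfolding that principal_form_def cross_term_def by algebra+
  \<comment> \<open>The form is \<open>s\<^sup>2 + (k * s + r) * r\<close>. If it is positive and
    its second summand is not, that summand has absolute value below \<open>s\<^sup>2\<close>, hence
    below \<open>r\<^sup>2\<close>.\<close>
  have shrink: "\<bar>k * s + r\<bar> < \<bar>r\<bar> \<or> 0 < (k * s + r) * r"
    if "0 < s\<^sup>2 + k * s * r + r\<^sup>2" "\<bar>s\<bar> \<le> \<bar>r\<bar>" "r \<noteq> 0" for r s :: int
  proof (rule ccontr)
    assume n: "\<not> ?thesis"
    then have "\<bar>r\<bar> * \<bar>r\<bar> \<le> \<bar>k * s + r\<bar> * \<bar>r\<bar>" by (intro mult_right_mono) auto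
    also have "\<dots> = - ((k * s + r) * r)" using n by (simp add: abs_mult[symmetric])
    also have "\<dots> < s\<^sup>2" using that(1) by (simp add: algebra_simps power2_eq_square)
    also have "\<dots> \<le> \<bar>r\<bar> * \<bar>r\<bar>" using that(2) by (metis abs_le_square_iff abs_mult_self_eq power2_eq_square)
    finally show False by simp
  qed
  consider (nonneg) "0 \<le> x" "0 \<le> y" | (nonpos) "x \<le> 0" "y \<le> 0"
    | (mixed) "x * y < 0"
    by (metis linorder_not_le mult_less_0_iff nle_le)
  then show ?case
  proof cases
    case nonneg
    then show ?thesis using det by blast
  next
    case nonpos
    then show ?thesis using det
      by (intro exI[of _ "- p"] exI[of _ "- z"] exI[of _ "- x"] exI[of _ "- y"])
        (simp add: principal_form_def cross_term_def)
  next
    case mixed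
    then have nz: "x \<noteq> 0" "y \<noteq> 0" by auto
    show ?thesis
    proof (cases "\<bar>x\<bar> \<le> \<bar>y\<bar>")
      case True
      define x' where "x' = k * x + y"
      note fw = forward[OF refl refl x'_def refl]
      from shrink[OF pos True nz(2)] show ?thesis
      proof
        assume "\<bar>k * x + y\<bar> < \<bar>y\<bar>"
        then have "nat (\<bar>x'\<bar> + \<bar>- x\<bar>) < nat (\<bar>x\<bar> + \<bar>y\<bar>)" by (simp add: x'_def)
        from less.hyps[OF this fw(1)] show ?thesis using fw(2,3) less.prems(2) by simp
      next
        assume "0 < (k * x + y) * y"
        then have "0 \<le> x' \<and> 0 \<le> - x \<or> x' \<le> 0 \<and> - x \<le> 0"
          using mixed by (auto simp: x'_def zero_less_mult_iff mult_less_0_iff)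
        then show ?thesis
        proof
          assume "0 \<le> x' \<and> 0 \<le> - x"
          then show ?thesis using fw by blast
        next
          assume "x' \<le> 0 \<and> - x \<le> 0"
          then show ?thesis using fw
            by (intro exI[of _ "- (k * p + z)"] exI[of _ p] exI[of _ "- x'"] exI[of _ x])
              (auto simp: principal_form_def cross_term_def algebra_simps)
        qed
      qed
    next
      case False
      define y' where "y' = k * y + x"
      note bw = backward[OF refl refl refl y'_def]
      have "0 < y\<^sup>2 + k * y * x + x\<^sup>2" using pos by (simp add: algebra_simps)
      from shrink[OF this _ nz(1)] False
      have "\<bar>k * y + x\<bar> < \<bar>x\<bar> \<or> 0 < (k * y + x) * x" by simp
      then show ?thesis
      proof
        assume "\<bar>k * y + x\<bar> < \<bar>x\<bar>"
        then have "nat (\<bar>- y\<bar> + \<bar>y'\<bar>) < nat (\<bar>x\<bar> + \<bar>y\<bar>)" by (simp add: y'_def)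
        from less.hyps[OF this bw(1)] show ?thesis using bw(2,3) less.prems(2) by simp
      next
        assume "0 < (k * y + x) * x"
        then have "0 \<le> y' \<and> 0 \<le> - y \<or> y' \<le> 0 \<and> - y \<le> 0"
          using mixed by (auto simp: y'_def zero_less_mult_iff mult_less_0_iff)
        then show ?thesis
        proof
          assume "0 \<le> y' \<and> 0 \<le> - y"
          then show ?thesis using bw by blast
        next
          assume "y' \<le> 0 \<and> - y \<le> 0"
          then show ?thesis using bw
            by (intro exI[of _ z] exI[of _ "- (p + k * z)"] exI[of _ y] exI[of _ "- y'"])
              (auto simp: principal_form_def cross_term_def algebra_simps)
        qed
      qed
    qed
  qed
qed

text \<open>Adding \<open>(x, y)\<close> to \<open>(p, z)\<close> adds \<open>m\<close> to
  \<open>u\<close>, so the bounds on \<open>u\<close> single out one translate: the one for which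
  \<open>(p, z)\<close> and \<open>(x - p, y - z)\<close> are neighbours with mediant
  \<open>(x, y)\<close>.\<close>

lemma principal_reduced:
  assumes "principal k m u" "0 < u" "u < m" "0 \<le> k"
  obtains p z x y where "p * y - z * x = 1" "1 \<le> p" "p \<le> x" "0 \<le> z" "z < y"
    "m = principal_form k x y" "u = cross_term k p z x y"
proof -
  obtain p\<^sub>0 z\<^sub>0 x\<^sub>0 y\<^sub>0 where "p\<^sub>0 * y\<^sub>0 - z\<^sub>0 * x\<^sub>0 = 1"
    "m = principal_form k x\<^sub>0 y\<^sub>0" "u = cross_term k p\<^sub>0 z\<^sub>0 x\<^sub>0 y\<^sub>0"
    using assms(1) unfolding principal_def by blast
  with principal_representation_same_sign[of p\<^sub>0 y\<^sub>0 z\<^sub>0 x\<^sub>0 k] assms(2,3)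
  obtain p z x y where det: "p * y - z * x = 1" and nonneg: "0 \<le> x" "0 \<le> y"
    and m: "m = principal_form k x y" and u: "u = cross_term k p z x y" by auto
  have "x \<noteq> 0"
  proof
    assume "x = 0"
    moreover from this have "y = 1" using det nonneg by (auto simp: zmult_eq_1_iff)
    ultimately show False using m assms by (simp add: principal_form_def)
  qed
  then have x: "1 \<le> x" using nonneg by simp
  have "y \<noteq> 0"
  proof
    assume "y = 0"
    moreover from this have "(- z) * x = 1" using det by simp
    then have "x = 1" using nonneg by (subst (asm) zmult_eq_1_iff) auto
    ultimately show False using m assms by (simp add: principal_form_def)
  qed
  then have y: "1 \<le> y" using nonneg by simp
  \<comment> \<open>Cramer's rule: the equations for the determinant and for \<open>u\<close> are
    linear in \<open>p\<close> and \<open>z\<close>, with determinant \<open>m\<close>.\<close>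
  have pm: "p * m = u * x + k * x + y" and zm: "z * m = u * y - x"
    using det unfolding m u principal_form_def cross_term_def by algebra+
  have "0 < u * x" "0 \<le> k * x" using assms x by auto
  then have "0 < p * m" using pm y by linarith
  then have p: "1 \<le> p" using assms by (simp add: zero_less_mult_iff)
  have "1 * 1 \<le> p * y" using p y by (intro mult_mono) auto
  then have "0 \<le> z * x" using det by simp
  then have z: "0 \<le> z" using x by (simp add: zero_le_mult_iff)
  have "u * y \<le> m * y" using assms y by (intro mult_right_mono) auto
  then have "z * m < y * m" using zm x by (simp add: mult.commute)
  then have zy: "z < y" using assms by simp
  have "z * x \<le> (y - 1) * x" using zy x by (intro mult_right_mono) auto
  then have "p * y \<le> x * y" using det x by (simp add: algebra_simps)
  then have "p \<le> x" using y by simp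
  then show ?thesis using that det p z zy m u by blast
qed

section \<open>Chains as products of matrices\<close>

text \<open>Each entry acts by the matrix with rows \<open>(b, - 1)\<close> and
  \<open>(1, 0)\<close>. The vector \<open>(1, 0)\<close> gives numerator and denominator of the
  continued fraction; other vectors allow extension at the end.\<close>

fun hj_act :: "int list \<Rightarrow> int \<times> int \<Rightarrow> int \<times> int" where
  "hj_act [] v = v"
| "hj_act (b # bs) v = (case hj_act bs v of (n, d) \<Rightarrow> (b * n - d, n))"

lemma hj_act_append: "hj_act (bs @ cs) v = hj_act bs (hj_act cs v)"
  by (induction bs) auto

lemma hj_value_eq_act:
  assumes "\<forall>b \<in> set bs. 2 \<le> b" "bs \<noteq> []" "hj_act bs (1, 0) = (m, u)"
  shows "0 < u \<and> u < m \<and> hj_value bs = of_int m / of_int u"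
  using assms
proof (induction bs arbitrary: m u rule: hj_value.induct)
  case (3 b b' bs)
  obtain n d where nd: "hj_act (b' # bs) (1, 0) = (n, d)" by (metis prod.exhaust)
  have IH: "0 < d" "d < n" "hj_value (b' # bs) = of_int n / of_int d"
    using "3.IH"[OF _ _ nd] "3.prems" by auto
  have m: "m = b * n - d" "u = n" using "3.prems"(3) nd by auto
  have "2 * n \<le> b * n" using "3.prems"(1) IH by (intro mult_right_mono) auto
  moreover have "hj_value (b # b' # bs) = of_int m / of_int u"
    using IH(1,2) unfolding hj_value.simps m IH(3) by (simp add: field_simps)
  ultimately show ?case using IH(1,2) unfolding m by linarith
qed auto

lemma wahl_chain_ge_2:
  assumes "wahl_chain k bs" "0 \<le> k"
  shows "bs \<noteq> [] \<and> (\<forall>b \<in> set bs. 2 \<le> b)"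
  using assms by (induction rule: wahl_chain.induct) auto

lemma hj_expansion_eq:
  assumes "bs \<noteq> []" "\<forall>b \<in> set bs. 2 \<le> b"
  shows "hj_expansion (hj_value bs) = bs"
  unfolding hj_expansion_def
  using hj_value_bounds[OF assms] assms by (intro the1_equality[OF hj_expansion_ex1]) auto

text \<open>
  The matrix of a Wahl chain with first column \<open>(m, u)\<close> has second column
  \<open>(-(m - u - k), -(u - v))\<close>, where \<open>v\<close> is the last coefficient of the form of \<open>(m, u)\<close>.
\<close>

definition wahl_matrix :: "int \<Rightarrow> int list \<Rightarrow> int \<Rightarrow> int \<Rightarrow> int \<Rightarrow> bool" where
  "wahl_matrix k bs m u v \<longleftrightarrow>
    (\<forall>n d. hj_act bs (n, d) = (m * n - (m - u - k) * d, u * n - (u - v) * d))"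

text \<open>On columns, \<open>(x, y)\<close> becomes \<open>(x + p, y + z)\<close> and
  \<open>(p, z)\<close> stays.\<close>

lemma wahl_matrix_incr_first:
  assumes "wahl_matrix k (b # bs) m u v"
  shows "wahl_matrix k ((b + 1) # bs @ [2]) (m + 2 * u + k + v) (u + v) v"
  unfolding wahl_matrix_def
proof (intro allI)
  fix n d
  obtain i j where ij: "hj_act bs (2 * n - d, n) = (i, j)" by (metis prod.exhaust)
  have "hj_act (b # bs) (2 * n - d, n)
      = (m * (2 * n - d) - (m - u - k) * n, u * (2 * n - d) - (u - v) * n)"
    using assms unfolding wahl_matrix_def by blast
  then have e: "b * i - j = m * (2 * n - d) - (m - u - k) * n" "i = u * (2 * n - d) - (u - v) * n"
    unfolding hj_act.simps ij prod.case prod.inject by blast+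
  have "hj_act ((b + 1) # bs @ [2]) (n, d) = (b * i - j + i, i)"
    using ij by (simp add: hj_act_append algebra_simps)
  also have "\<dots> = ((m + 2 * u + k + v) * n - (m + 2 * u + k + v - (u + v) - k) * d,
      (u + v) * n - (u + v - v) * d)"
    unfolding e(1) unfolding e(2) by (simp add: algebra_simps)
  finally show "hj_act ((b + 1) # bs @ [2]) (n, d)
    = ((m + 2 * u + k + v) * n - (m + 2 * u + k + v - (u + v) - k) * d,
      (u + v) * n - (u + v - v) * d)" .
qed

text \<open>On columns, \<open>(x, y)\<close> becomes \<open>(2 * x - p, 2 * y - z)\<close> and
  \<open>(p, z)\<close> becomes the old \<open>(x, y)\<close>.\<close>

lemma wahl_matrix_incr_last:
  assumes "wahl_matrix k (bs @ [b]) m u v"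
  shows "wahl_matrix k (2 # bs @ [b + 1]) (4 * m - 4 * u - 2 * k + v) (2 * m - u - k) m"
  unfolding wahl_matrix_def
proof (intro allI)
  fix n d
  have "hj_act (bs @ [b + 1]) (n, d) = hj_act (bs @ [b]) (n, d - n)"
    by (simp add: hj_act_append algebra_simps)
  also have "\<dots> = (m * n - (m - u - k) * (d - n), u * n - (u - v) * (d - n))"
    using assms unfolding wahl_matrix_def by blast
  finally show "hj_act (2 # bs @ [b + 1]) (n, d)
    = ((4 * m - 4 * u - 2 * k + v) * n
        - (4 * m - 4 * u - 2 * k + v - (2 * m - u - k) - k) * d,
      (2 * m - u - k) * n - (2 * m - u - k - m) * d)"
    by (simp add: algebra_simps)
qed

text \<open>Of the neighbours \<open>(p, z)\<close> and \<open>(x - p, y - z)\<close>, the larger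
  one is the newer; undoing its creation undoes one chain operation.\<close>

lemma wahl_chain_of_neighbours:
  assumes "p * y - z * x = 1" "1 \<le> p" "p \<le> x" "0 \<le> z" "z < y" "0 \<le> k"
  shows "\<exists>bs. wahl_chain k bs \<and>
    wahl_matrix k bs (principal_form k x y) (cross_term k p z x y) (principal_form k p z)"
  using assms
proof (induction "nat (x + y)" arbitrary: p z x y rule: less_induct)
  case less
  note det = less.prems(1)
  have mediant: "(2 * p - x) * y - (2 * z - y) * x = 2" using det by algebra
  \<comment> \<open>The strictness of each inequality is what the induction hypothesis demands of
    the predecessor.\<close>
  consider (first) "2 * p \<le> x" "2 * z < y" | (last) "x < 2 * p" "y \<le> 2 * z"
    | (none) "x < 2 * p" "2 * z < y" | (absurd) "2 * p \<le> x" "y \<le> 2 * z"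
    by linarith
  then show ?case
  proof cases
    case first
    have "\<exists>bs. wahl_chain k bs \<and> wahl_matrix k bs (principal_form k (x - p) (y - z))
        (cross_term k p z (x - p) (y - z)) (principal_form k p z)"
      by (rule less.hyps) (use first less.prems in \<open>auto simp: algebra_simps\<close>)
    then obtain bs where bs: "wahl_chain k bs" "wahl_matrix k bs (principal_form k (x - p) (y - z))
        (cross_term k p z (x - p) (y - z)) (principal_form k p z)" by blast
    obtain b cs where c: "bs = b # cs"
      using wahl_chain_ge_2[OF bs(1) less.prems(6)] by (cases bs) auto
    have "principal_form k (x - p) (y - z) + 2 * cross_term k p z (x - p) (y - z) + k
        + principal_form k p z = principal_form k x y"
      using det unfolding principal_form_def cross_term_def by algebra
    moreover have "cross_term k p z (x - p) (y - z) + principal_form k p z = cross_term k p z x y"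
      by (simp add: principal_form_def cross_term_def algebra_simps power2_eq_square)
    ultimately show ?thesis
      using wahl_matrix_incr_first[OF bs(2)[unfolded c]] wahl_chain.incr_first[OF bs(1)[unfolded c]]
      by metis
  next
    case last
    define p' where "p' = 2 * p - x"
    define z' where "z' = 2 * z - y"
    have "\<exists>bs. wahl_chain k bs \<and> wahl_matrix k bs (principal_form k p z)
        (cross_term k p' z' p z) (principal_form k p' z')"
      by (rule less.hyps) (use last less.prems in \<open>auto simp: p'_def z'_def algebra_simps\<close>)
    then obtain bs where bs: "wahl_chain k bs" "wahl_matrix k bs (principal_form k p z)
        (cross_term k p' z' p z) (principal_form k p' z')" by blast
    obtain b cs where c: "bs = cs @ [b]"
      using wahl_chain_ge_2[OF bs(1) less.prems(6)] by (cases bs rule: rev_cases) auto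
    have "4 * principal_form k p z - 4 * cross_term k p' z' p z - 2 * k + principal_form k p' z'
        = principal_form k x y"
      "2 * principal_form k p z - cross_term k p' z' p z - k = cross_term k p z x y"
      using det unfolding principal_form_def cross_term_def p'_def z'_def by algebra+
    then show ?thesis
      using wahl_matrix_incr_last[OF bs(2)[unfolded c]] wahl_chain.incr_last[OF bs(1)[unfolded c]]
      by metis
  next
    case none
    \<comment> \<open>Here \<open>x + y \<le> 2\<close>, which leaves only the root neighbours
      \<open>(1, 0)\<close> and \<open>(0, 1)\<close>.\<close>
    have "1 * y \<le> (2 * p - x) * y" "1 * x \<le> (y - 2 * z) * x"
      using none less.prems by (intro mult_right_mono; simp)+
    moreover have "(2 * p - x) * y + (y - 2 * z) * x = 2" using mediant by (simp add: algebra_simps)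
    ultimately have xy: "x = 1" "y = 1" using less.prems by linarith+
    moreover from xy have "p = 1" "z = 0" using none less.prems by auto
    ultimately have "wahl_matrix k [k + 2] (principal_form k x y) (cross_term k p z x y)
        (principal_form k p z)"
      by (simp add: wahl_matrix_def principal_form_def cross_term_def algebra_simps)
    then show ?thesis using wahl_chain.base by blast
  next
    case absurd
    have "(2 * p - x) * y \<le> 0" "0 \<le> (2 * z - y) * x"
      using absurd less.prems by (auto simp: mult_nonpos_nonneg)
    then show ?thesis using mediant by linarith
  qed
qed

theorem wahl_chain_principal:
  assumes "principal k m u" "0 < u" "u < m" "0 \<le> k"
  shows "wahl_chain k (hj_expansion (of_int m / of_int u))"
proof -
  obtain p z x y where h: "p * y - z * x = 1" "1 \<le> p" "p \<le> x" "0 \<le> z" "z < y"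
    "m = principal_form k x y" "u = cross_term k p z x y"
    using principal_reduced[OF assms] .
  obtain bs v where bs: "wahl_chain k bs" "wahl_matrix k bs m u v"
    using wahl_chain_of_neighbours[OF h(1-5) assms(4)] h(6,7) by blast
  have "hj_act bs (1, 0) = (m, u)" using bs(2) unfolding wahl_matrix_def by simp
  then have "hj_value bs = of_int m / of_int u"
    using hj_value_eq_act wahl_chain_ge_2[OF bs(1) assms(4)] by blast
  then show ?thesis using hj_expansion_eq[of bs] wahl_chain_ge_2[OF bs(1) assms(4)] bs(1) by simp
qed

section \<open>The Markov tree\<close>

text \<open>The two equations give the lower left entries \<open>- c\<close> and \<open>- a\<close>
  of the matrix products for \<open>a, b\<close> and for \<open>b, c\<close>.\<close>

definition linked :: "int \<Rightarrow> markov_triple \<Rightarrow> int \<Rightarrow> int \<Rightarrow> int \<Rightarrow> bool" where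
  "linked k v u\<^sub>a u\<^sub>b u\<^sub>c \<longleftrightarrow> (case v of (a, b, c) \<Rightarrow>
     principal k a u\<^sub>a \<and> principal k b u\<^sub>b \<and> principal k c u\<^sub>c \<and>
     c = a * u\<^sub>b - (u\<^sub>a + k) * b \<and> a = b * u\<^sub>c - (u\<^sub>b + k) * c)"

lemma linked_reflect:
  assumes "linked k (a, b, c) u\<^sub>a u\<^sub>b u\<^sub>c"
  shows "linked k (c, b, a) (- u\<^sub>c - k) (- u\<^sub>b - k) (- u\<^sub>a - k)"
  using assms principal_reflect unfolding linked_def by (auto simp: algebra_simps)

lemma linked_mutation:
  assumes "linked k (a, b, c) u\<^sub>a u\<^sub>b u\<^sub>c" "b \<noteq> 0" "c \<noteq> 0"
    and b': "c * b' = a\<^sup>2 + k * a * b + b\<^sup>2"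
  obtains u' where "linked k (a, b', b) u\<^sub>a u' u\<^sub>b"
proof -
  have h: "principal k a u\<^sub>a" "principal k b u\<^sub>b" "principal k c u\<^sub>c"
    "c = a * u\<^sub>b - (u\<^sub>a + k) * b" "a = b * u\<^sub>c - (u\<^sub>b + k) * c"
    using assms(1) unfolding linked_def prod.case by blast+
  obtain u' where u': "principal k b' u'" "a = b' * u\<^sub>b - (u' + k) * b"
    using principal_mutation[OF h(2,3) assms(3) h(5)] b' unfolding principal_form_def by metis
  \<comment> \<open>Eliminating \<open>b * u'\<close> turns the left side into
    \<open>c * b' - k * a * b - a\<^sup>2\<close>.\<close>
  have "b * (a * u' - (u\<^sub>a + k) * b') = b * b"
    using u'(2) h(4) b' by algebra
  then have "b = a * u' - (u\<^sub>a + k) * b'" using assms(2) by simp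
  then show ?thesis using that h u' unfolding linked_def prod.case by blast
qed

text \<open>The exceptional value \<open>u\<^sub>a = -k\<close> occurs at the leftmost entry of the tree.\<close>

lemma linked_MT_at:
  assumes "0 \<le> k"
  shows "MT_at k p = (a, b, c) \<Longrightarrow> \<exists>u\<^sub>a u\<^sub>b u\<^sub>c. linked k (a, b, c) u\<^sub>a u\<^sub>b u\<^sub>c \<and>
    (0 \<le> u\<^sub>a \<or> a = 1 \<and> u\<^sub>a = - k) \<and> 0 < u\<^sub>b \<and> u\<^sub>b < b \<and> u\<^sub>c \<le> c"
proof (induction p arbitrary: a b c)
  case Nil
  then have abc: "a = 1" "b = k + 2" "c = 1" by (auto simp: MT_root_def)
  have "principal k 1 (- k)"
    by (rule principalI[of 0 0 "-1" 1]) (auto simp: principal_form_def cross_term_def)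
  moreover have "principal k (k + 2) 1"
    by (rule principalI[of 1 1 0 1]) (auto simp: principal_form_def cross_term_def)
  moreover have "principal k 1 1"
    by (rule principalI[of 1 1 1 0]) (auto simp: principal_form_def cross_term_def)
  \<comment> \<open>Here \<open>u\<^sub>c = c = 1\<close>, hence the non-strict bound in the
    invariant.\<close>
  ultimately have "linked k (a, b, c) (- k) 1 1" using abc by (simp add: linked_def)
  then show ?case using abc assms by (intro exI[of _ "- k"] exI[of _ 1]) auto
next
  case (Cons mv p)
  \<comment> \<open>The first relation makes \<open>a * u\<^sub>b\<close> positive, since
    \<open>u\<^sub>a + k\<close> is nonnegative even in the exceptional case; the second gives the
    upper bound.\<close>
  have bounds: "0 < u\<^sub>b \<and> u\<^sub>b < b"
    if "linked k (a, b, c) u\<^sub>a u\<^sub>b u\<^sub>c" "0 \<le> u\<^sub>a \<or> a = 1 \<and> u\<^sub>a = - k" "u\<^sub>c \<le> c" for u\<^sub>a u\<^sub>b u\<^sub>c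
  proof -
    have pos: "1 \<le> a" "1 \<le> c" "1 \<le> b" using MT_at_invariants(1)[OF assms Cons.prems] by auto
    have e: "c = a * u\<^sub>b - (u\<^sub>a + k) * b" "a = b * u\<^sub>c - (u\<^sub>b + k) * c"
      using that(1) unfolding linked_def prod.case by blast+
    have "0 \<le> (u\<^sub>a + k) * b" using that(2) pos assms by auto
    then have "0 < a * u\<^sub>b" using e(1) pos by linarith
    moreover have "b * u\<^sub>c \<le> b * c" using that(3) pos by simp
    then have "(u\<^sub>b + k) * c < b * c" using e(2) pos by linarith
    ultimately show ?thesis using pos assms by (simp add: zero_less_mult_iff)
  qed
  obtain a' b' c' where v: "MT_at k p = (a', b', c')" by (metis prod.exhaust)
  note i = MT_at_invariants[OF assms v]
  have nz: "a' \<noteq> 0" "b' \<noteq> 0" "c' \<noteq> 0" using i(1) by auto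
  obtain u\<^sub>a u\<^sub>b u\<^sub>c where IH: "linked k (a', b', c') u\<^sub>a u\<^sub>b u\<^sub>c"
    "0 \<le> u\<^sub>a \<or> a' = 1 \<and> u\<^sub>a = - k" "0 < u\<^sub>b" "u\<^sub>b < b'" "u\<^sub>c \<le> c'"
    using Cons.IH[OF v] by blast
  show ?case
  proof (cases mv)
    case L
    have e: "a = a'" "c = b'" "b = (a'\<^sup>2 + k * a' * b' + b'\<^sup>2) div c'"
      using L Cons.prems v by auto
    have "c' * b = a'\<^sup>2 + k * a' * b' + b'\<^sup>2" using e(3) i(2) by simp
    from linked_mutation[OF IH(1) nz(2,3) this]
    obtain u' where u': "linked k (a, b, c) u\<^sub>a u' u\<^sub>b" unfolding e(1,2) .
    have "0 \<le> u\<^sub>a \<or> a = 1 \<and> u\<^sub>a = - k" "u\<^sub>b \<le> c" using IH(2,4) e(1,2) by auto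
    then show ?thesis using u' bounds[OF u'] by blast
  next
    case R
    have e: "a = b'" "c = c'" "b = (b'\<^sup>2 + k * b' * c' + c'\<^sup>2) div a'"
      using R Cons.prems v by auto
    have "a' * b = c'\<^sup>2 + k * c' * b' + b'\<^sup>2" using e(3) i(3) by (simp add: algebra_simps)
    from linked_mutation[OF linked_reflect[OF IH(1)] nz(2,1) this]
    obtain u' where "linked k (c, b, a) (- u\<^sub>c - k) u' (- u\<^sub>b - k)" unfolding e(1,2) .
    from linked_reflect[OF this] have u': "linked k (a, b, c) u\<^sub>b (- u' - k) u\<^sub>c" by simp
    have "0 \<le> u\<^sub>b \<or> a = 1 \<and> u\<^sub>b = - k" "u\<^sub>c \<le> c" using IH(3,5) e(1,2) by auto
    then show ?thesis using u' bounds[OF u'] by blast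
  qed
qed

theorem theorem8p2:
  fixes k :: int and t :: rat
  assumes "0 \<le> k" and "0 < t" and "t < 1"
  shows "wahl_chain k (hj_expansion (of_int (markov_number k t) / of_int (u_plus k t)))"
proof -
  have "FT_vertex t \<in> FT"
    using theI'[OF FT_vertex_ex1[OF assms(2)]] unfolding FT_vertex_def by blast
  then obtain q where q: "FT_vertex t = FT_at q" unfolding FT_def by blast
  obtain a b c where v: "MT_at k q = (a, b, c)" by (metis prod.exhaust)
  obtain u\<^sub>a u\<^sub>b u\<^sub>c where u: "linked k (a, b, c) u\<^sub>a u\<^sub>b u\<^sub>c" "0 < u\<^sub>b" "u\<^sub>b < b"
    using linked_MT_at[OF assms(1) v] by blast
  \<comment> \<open>Modulo \<open>b\<close>, the first relation is the congruence that determines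
    \<open>u_plus\<close>.\<close>
  have "a * u\<^sub>b - c = b * (u\<^sub>a + k)" using u(1) by (simp add: linked_def algebra_simps)
  then have "[a * u\<^sub>b = c] (mod b)" by (simp add: cong_iff_dvd_diff)
  moreover have "(a, b, c) \<in> MT k" unfolding MT_def using v by (metis rangeI)
  ultimately have "u_plus k t = u\<^sub>b"
    unfolding u_plus_def q theta_FT_at v prod.case
    using u(2,3) by (intro the1_equality[OF u_plus_ex1[OF assms(1)]]) auto
  moreover have "markov_number k t = b" by (simp add: markov_number_def q v)
  moreover have "principal k b u\<^sub>b" using u(1) by (simp add: linked_def)
  ultimately show ?thesis using wahl_chain_principal u(2,3) assms(1) by simp
qed

end
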